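(* Let $E$ be a Hermite–Biehler function such that every polynomial belongs to the de Branges space $\mathcal{H}(E)$, and let $\mathbb{H}_{\Phi,\mu}$ be bounded in $\mathcal{H}(E)$. Then: (i) $\sup_{n\in\mathbb{Z}_+}|\lambda_n|\le r(\mathbb{H}_{\Phi,\mu})$, where $r(\mathbb{H}_{\Phi,\mu})$ is the spectral radius of the operator $\mathbb{H}_{\Phi,\mu}$ on $\mathcal{H}(E)$. (ii) If, in addition, $\Phi\ge 0$ and $\mathbb{H}_{\Phi,\mu}\neq 0$, then $\liminf_{n\to\infty}\sqrt[n]{\lambda_n}>0$ and $\Phi(u)=0$ for $\mu$-a.e. $u\in(0,\tfrac1A)$, where $A:=\sup_{n\ge 1}\sqrt[n]{\lambda_n}<\infty$.
   Context: $\mu$ is a regular positive Borel measure on $(0,\infty)$ and $\Phi:(0,\infty)\to\mathbb{C}$ is $\mu$-measurable. The Hausdorff operator is $$(\mathbb{H}_{\Phi,\mu}F)(z)=\int_0^\infty \Phi(u)\,F\left(\tfrac{z}{u}\right)d\mu(u),\quad z\in\mathbb{C}.$$ For $n\in\mathbb{Z}_+=\{0,1,2,\dots\}$ put $\lambda_n:=\int_0^\infty\Phi(u)u^{-n}\,d\mu(u)$; it is a standing assumption that these integrals exist. An entire function $E$ is in the Hermite–Biehler class if $|E(z)|>|E^{\#}(z)|$ for $z$ in the open upper half-plane $\mathbb{C}^+$, where $F^{\#}(z):=\overline{F(\overline z)}$. The de Branges space is $\mathcal{H}(E)=\{F \text{ entire}: F/E,\ F^{\#}/E\in H^2(\mathbb{C}^+)\}$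 ($H^2(\mathbb{C}^+)$ is the Hardy space of the upper half-plane), a Hilbert space with norm $\|F\|_E^2=\int_{-\infty}^\infty |F(t)/E(t)|^2dt$. "$\mathbb{H}_{\Phi,\mu}$ is bounded in $\mathcal{H}(E)$" means that $\mathbb{H}_{\Phi,\mu}F$ is defined and belongs to $\mathcal{H}(E)$ for every $F\in\mathcal{H}(E)$ and that $\mathbb{H}_{\Phi,\mu}$ is a bounded linear operator on $\mathcal{H}(E)$. *)

theory Defs
  imports "HOL-Complex_Analysis.Complex_Analysis"
begin

definition upper_half_plane :: "complex set" where
  "upper_half_plane = {z. Im z > 0}"

definition sharp :: "(complex \<Rightarrow> complex) \<Rightarrow> complex \<Rightarrow> complex" where
  "sharp F z = cnj (F (cnj z))"

definition hermite_biehler :: "(complex \<Rightarrow> complex) \<Rightarrow> bool" where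
  "hermite_biehler E \<longleftrightarrow>
     E holomorphic_on UNIV \<and> (\<forall>z\<in>upper_half_plane. cmod (E z) > cmod (sharp E z))"

definition hardy2_upper :: "(complex \<Rightarrow> complex) set" where
  "hardy2_upper =
     {f. f holomorphic_on upper_half_plane \<and>
         (SUP y\<in>{0<..}. \<integral>\<^sup>+x. ennreal ((cmod (f (Complex x y)))\<^sup>2) \<partial>lborel) < \<infinity>}"

definition de_branges :: "(complex \<Rightarrow> complex) \<Rightarrow> (complex \<Rightarrow> complex) set" where
  "de_branges E =
     {F. F holomorphic_on UNIV \<and>
         (\<lambda>z. F z / E z) \<in> hardy2_upper \<and> (\<lambda>z. sharp F z / E z) \<in> hardy2_upper}"

definition de_branges_norm :: "(complex \<Rightarrow> complex) \<Rightarrow> (complex \<Rightarrow> complex) \<Rightarrow> real" where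
  "de_branges_norm E F =
     sqrt (LINT t|lborel. (cmod (F (complex_of_real t) / E (complex_of_real t)))\<^sup>2)"

text \<open>Elements of the de Branges space are genuine functions, so an operator on it is a map on
  all functions of which only the values on the space matter.\<close>

definition bounded_operator ::
  "(complex \<Rightarrow> complex) \<Rightarrow> ((complex \<Rightarrow> complex) \<Rightarrow> complex \<Rightarrow> complex) \<Rightarrow> bool" where
  "bounded_operator E T \<longleftrightarrow>
     (\<forall>F\<in>de_branges E. T F \<in> de_branges E) \<and>
     (\<forall>F\<in>de_branges E. \<forall>G\<in>de_branges E. T (\<lambda>z. F z + G z) = (\<lambda>z. T F z + T G z)) \<and>
     (\<forall>F\<in>de_branges E. \<forall>c. T (\<lambda>z. c * F z) = (\<lambda>z. c * T F z)) \<and>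
     (\<exists>C. \<forall>F\<in>de_branges E. de_branges_norm E (T F) \<le> C * de_branges_norm E F)"

text \<open>The complement of the set of all \<open>\<zeta>\<close> for which \<open>\<zeta> I - T\<close> has a two-sided inverse \<open>S\<close>
  among the bounded operators on the space.\<close>

definition op_spectrum ::
  "(complex \<Rightarrow> complex) \<Rightarrow> ((complex \<Rightarrow> complex) \<Rightarrow> complex \<Rightarrow> complex) \<Rightarrow> complex set" where
  "op_spectrum E T =
     - {\<zeta>. \<exists>S. bounded_operator E S \<and>
             (\<forall>F\<in>de_branges E. S (\<lambda>z. \<zeta> * F z - T F z) = F \<and>
                                (\<lambda>z. \<zeta> * S F z - T (S F) z) = F)}"

definition op_spectral_radius ::
  "(complex \<Rightarrow> complex) \<Rightarrow> ((complex \<Rightarrow> complex) \<Rightarrow> complex \<Rightarrow> complex) \<Rightarrow> ereal" where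
  "op_spectral_radius E T = (SUP \<zeta>\<in>op_spectrum E T. ereal (cmod \<zeta>))"

text \<open>Every Borel set is outer regular and inner regular. Finiteness on compact sets
  is not required.\<close>

definition regular_borel_measure :: "real measure \<Rightarrow> bool" where
  "regular_borel_measure \<mu> \<longleftrightarrow>
     sets \<mu> = sets (restrict_space borel {0<..}) \<and>
     (\<forall>B\<in>sets \<mu>.
        emeasure \<mu> B = (INF U\<in>{U. B \<subseteq> U \<and> U \<subseteq> {0<..} \<and> open U}. emeasure \<mu> U) \<and>
        emeasure \<mu> B = (SUP K\<in>{K. K \<subseteq> B \<and> compact K}. emeasure \<mu> K))"

text \<open>A \<open>\<mu>\<close>-measurable function is one that is measurable for the completion of the Borel measure
  \<open>\<mu>\<close>, hence the integrals below are taken with respect to the completion; for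
  Borel functions this is the integral with respect to \<open>\<mu>\<close> itself.\<close>

definition hausdorff_op ::
  "(real \<Rightarrow> complex) \<Rightarrow> real measure \<Rightarrow> (complex \<Rightarrow> complex) \<Rightarrow> complex \<Rightarrow> complex" where
  "hausdorff_op \<Phi> \<mu> F z = (LINT u|completion \<mu>. \<Phi> u * F (z / complex_of_real u))"

definition hausdorff_moment :: "(real \<Rightarrow> complex) \<Rightarrow> real measure \<Rightarrow> nat \<Rightarrow> complex" where
  "hausdorff_moment \<Phi> \<mu> n = (LINT u|completion \<mu>. \<Phi> u / complex_of_real u ^ n)"

definition hausdorff_bounded ::
  "(complex \<Rightarrow> complex) \<Rightarrow> (real \<Rightarrow> complex) \<Rightarrow> real measure \<Rightarrow> bool" where
  "hausdorff_bounded E \<Phi> \<mu> \<longleftrightarrow>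
     (\<forall>F\<in>de_branges E. \<forall>z.
        integrable (completion \<mu>) (\<lambda>u. \<Phi> u * F (z / complex_of_real u))) \<and>
     bounded_operator E (hausdorff_op \<Phi> \<mu>)"

end

theory Submission
  imports Defs
begin

text \<open>
  Pulling \<open>z ^ n\<close> out of the integral shows that every monomial is an eigenvector of the Hausdorff
  operator, with eigenvalue \<open>\<lambda>\<^sub>n\<close>. Eigenvalues lie in the spectrum, which is (i).

  Boundedness of the operator also gives a bound \<open>\<bar>\<lambda>\<^sub>n\<bar> \<le> C\<close> with \<open>C\<close> independent of \<open>n\<close>, provided
  that the monomials have nonzero norm. This is where the Hardy space enters: Fatou's lemma along
  horizontal lines descending to the real axis shows that \<open>F / E\<close> is square integrable on the axis
  (so the norm is an honest integral), and \<open>F\<close> and \<open>E\<close> have only countably many real zeros. With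
  such a \<open>C\<close>, the quantity \<open>A\<close> of (ii) is at most \<open>max 1 C\<close>.

  The rest of (ii) concerns the negative moments \<open>\<lambda>\<^sub>n\<close> of a nonnegative density \<open>\<Phi>\<close> on the
  positive half-line, where the mass of \<open>\<Phi>\<close> on \<open>(0, b]\<close> is at most \<open>b ^ n * \<lambda>\<^sub>n\<close>. If the operator
  is not zero, then \<open>\<Phi>\<close> does not vanish almost everywhere, so this mass is positive for some \<open>b\<close>,
  and taking \<open>n\<close>-th roots gives \<open>liminf \<ge> 1 / b\<close>. If \<open>b < 1 / A\<close>, the bound is at most
  \<open>(A * b) ^ n\<close> and tends to zero, so \<open>\<Phi>\<close> vanishes almost everywhere on \<open>(0, b]\<close>.
\<close>

section \<open>The norm of a de Branges space\<close>

text \<open>The zeros of an entire function that is not identically zero are isolated, hence countable.\<close>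

lemma entire_nonzero_ae_real:
  assumes "f holomorphic_on UNIV" and "f z0 \<noteq> 0"
  shows "AE t in lborel. f (complex_of_real t) \<noteq> 0"
proof -
  have "countable {z. f z = 0}"
  proof (cases "f constant_on UNIV")
    case True
    then have "{z. f z = 0} = {}"
      using assms(2) by (auto simp: constant_on_def)
    then show ?thesis by simp
  next
    case False
    then show ?thesis
      using holomorphic_countable_zeros[OF assms(1)] by (simp add: connected_UNIV)
  qed
  then have "countable (complex_of_real -` {z. f z = 0})"
    by (intro countable_image_inj_on[of complex_of_real] countable_subset[OF image_vimage_subset])
      (auto simp: inj_on_def)
  then have "complex_of_real -` {z. f z = 0} \<in> null_sets lborel"
    by (rule countable_imp_null_set_lborel)
  then have "AE t in lborel. t \<notin> complex_of_real -` {z. f z = 0}"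
    by (rule AE_not_in)
  then show ?thesis by simp
qed

lemma hermite_biehler_nonzero:
  assumes "hermite_biehler E" and "Im z > 0"
  shows "E z \<noteq> 0"
  using assms unfolding hermite_biehler_def upper_half_plane_def by fastforce

text \<open>The Hardy norm controls the integrals over all horizontal lines in the upper half-plane, so
  Fatou's lemma bounds the integral over the real axis. Real zeros of \<open>E\<close> do no harm here: at such a
  point \<open>F / E\<close> has the value \<open>0\<close>, which is below any lower limit.\<close>

lemma de_branges_square_integrable:
  assumes E: "hermite_biehler E" and F: "F \<in> de_branges E"
  shows "integrable lborel (\<lambda>t. (cmod (F (complex_of_real t) / E (complex_of_real t)))\<^sup>2)"
proof -
  define q where "q y t = (cmod (F (Complex t y) / E (Complex t y)))\<^sup>2" for y t :: real
  define Y where "Y k = 1 / real (Suc k)" for k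
  have contE: "continuous_on UNIV E" and contF: "continuous_on UNIV F"
    using E F by (auto simp: hermite_biehler_def de_branges_def
        intro: holomorphic_on_imp_continuous_on)
  have line: "(\<lambda>t. f (Complex t y)) \<in> borel_measurable lborel"
    if "continuous_on UNIV f" for f :: "complex \<Rightarrow> complex" and y
    using that unfolding Complex_eq
    by (auto intro!: borel_measurable_continuous_onI continuous_intros
        elim!: continuous_on_compose2)
  have meas [measurable]: "q y \<in> borel_measurable lborel" for y
  proof -
    note [measurable] = line[OF contE, of y] line[OF contF, of y]
    show ?thesis unfolding q_def by measurable
  qed
  have Y: "Y k > 0" for k by (simp add: Y_def)
  have Y0: "Y \<longlonglongrightarrow> 0" unfolding Y_def by (rule LIMSEQ_Suc[OF lim_1_over_n])
  have "ennreal (q 0 t) \<le> liminf (\<lambda>k. ennreal (q (Y k) t))" for t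
  proof (cases "E (Complex t 0) = 0")
    case True
    then show ?thesis by (simp add: q_def)
  next
    case False
    have "(\<lambda>k. Complex t (Y k)) \<longlonglongrightarrow> Complex t 0"
      by (intro tendsto_intros Y0)
    moreover have "isCont E (Complex t 0)" "isCont F (Complex t 0)"
      using contE contF by (auto simp: continuous_on_eq_continuous_at)
    ultimately have "(\<lambda>k. q (Y k) t) \<longlonglongrightarrow> q 0 t"
      unfolding q_def using False
      by (intro tendsto_intros) (auto intro: isCont_tendsto_compose)
    then have "(\<lambda>k. ennreal (q (Y k) t)) \<longlonglongrightarrow> ennreal (q 0 t)"
      by (rule tendsto_ennrealI)
    then show ?thesis
      using lim_imp_Liminf[OF sequentially_bot] by fastforce
  qed
  then have "(\<integral>\<^sup>+t. ennreal (q 0 t) \<partial>lborel)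
      \<le> (\<integral>\<^sup>+t. liminf (\<lambda>k. ennreal (q (Y k) t)) \<partial>lborel)"
    by (intro nn_integral_mono)
  also have "\<dots> \<le> liminf (\<lambda>k. \<integral>\<^sup>+t. ennreal (q (Y k) t) \<partial>lborel)"
    by (intro nn_integral_liminf) measurable
  also have "\<dots> \<le> limsup (\<lambda>k. \<integral>\<^sup>+t. ennreal (q (Y k) t) \<partial>lborel)"
    by (intro Liminf_le_Limsup) simp
  also have "\<dots> \<le> (SUP y\<in>{0<..}. \<integral>\<^sup>+t. ennreal (q y t) \<partial>lborel)"
    by (intro Limsup_bounded always_eventually allI SUP_upper) (simp add: Y)
  also have "\<dots> < \<infinity>"
    using F by (simp add: de_branges_def hardy2_upper_def q_def)
  finally have "integrable lborel (q 0)"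
    by (intro integrableI_nonneg) (auto simp: q_def[of 0] intro!: meas[unfolded q_def])
  then show ?thesis
    unfolding q_def complex_of_real_def .
qed

text \<open>Integrability is essential: the integral of a nonnegative function that is not integrable is
  \<open>0\<close> by convention, so without it the norm could vanish for trivial reasons.\<close>

lemma de_branges_norm_pos:
  assumes E: "hermite_biehler E" and F: "F \<in> de_branges E" and nz: "F z0 \<noteq> 0"
  shows "de_branges_norm E F > 0"
proof -
  let ?q = "\<lambda>t. (cmod (F (complex_of_real t) / E (complex_of_real t)))\<^sup>2"
  have "E \<i> \<noteq> 0" using hermite_biehler_nonzero[OF E, of \<i>] by simp
  then have "AE t in lborel. E (complex_of_real t) \<noteq> 0"
    using E by (intro entire_nonzero_ae_real) (auto simp: hermite_biehler_def)
  moreover have "AE t in lborel. F (complex_of_real t) \<noteq> 0"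
    using F nz by (intro entire_nonzero_ae_real) (auto simp: de_branges_def)
  ultimately have nz': "AE t in lborel. ?q t \<noteq> 0"
    by eventually_elim simp
  have "(LINT t|lborel. ?q t) \<noteq> 0"
  proof
    assume "(LINT t|lborel. ?q t) = 0"
    then have "AE t in lborel. ?q t = 0"
      using integral_nonneg_eq_0_iff_AE[OF de_branges_square_integrable[OF E F]] by simp
    with nz' have "AE t in (lborel :: real measure). False"
      by eventually_elim simp
    then show False
      by (simp add: AE_iff_null null_sets_def)
  qed
  moreover have "(LINT t|lborel. ?q t) \<ge> 0"
    by (intro integral_nonneg_AE) simp
  ultimately have "(LINT t|lborel. ?q t) > 0" by linarith
  then show ?thesis
    unfolding de_branges_norm_def by (rule real_sqrt_gt_zero)
qed

lemma de_branges_norm_mult: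
  "de_branges_norm E (\<lambda>z. c * F z) = cmod c * de_branges_norm E F"
proof -
  have "(\<lambda>t. (cmod (c * F (complex_of_real t) / E (complex_of_real t)))\<^sup>2)
      = (\<lambda>t. (cmod c)\<^sup>2 * (cmod (F (complex_of_real t) / E (complex_of_real t)))\<^sup>2)"
    by (simp add: norm_mult norm_divide power_mult_distrib power_divide)
  then show ?thesis
    by (simp add: de_branges_norm_def real_sqrt_mult)
qed

section \<open>Eigenvalues of the Hausdorff operator\<close>

text \<open>An inverse of \<open>c I - T\<close> would have to map \<open>c F - T F = 0\<close> back to \<open>F \<noteq> 0\<close>, but by linearity it
  maps \<open>0\<close> to \<open>0\<close>.\<close>

lemma eigenvalue_in_op_spectrum:
  assumes F: "F \<in> de_branges E" and nz: "F z0 \<noteq> 0" and TF: "T F = (\<lambda>z. c * F z)"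
  shows "c \<in> op_spectrum E T"
proof (rule ccontr)
  assume "c \<notin> op_spectrum E T"
  then obtain S where S: "bounded_operator E S" and inv: "S (\<lambda>z. c * F z - T F z) = F"
    using F by (auto simp: op_spectrum_def)
  from S have "S (\<lambda>z. 0 * F z) = (\<lambda>z. 0 * S F z)"
    using F unfolding bounded_operator_def by blast
  with inv TF have "F = (\<lambda>z. 0)" by simp
  with nz show False by simp
qed

text \<open>Eigenvalues are at most the operator norm. An eigenvector of norm \<open>0\<close> would give no bound,
  and this is what positivity of the norm excludes.\<close>

lemma eigenvalues_bounded:
  assumes E: "hermite_biehler E" and T: "bounded_operator E T"
  obtains C where
    "\<And>F c z0. F \<in> de_branges E \<Longrightarrow> F z0 \<noteq> 0 \<Longrightarrow> T F = (\<lambda>z. c * F z) \<Longrightarrow> cmod c \<le> C"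
proof -
  obtain C where C: "\<And>F. F \<in> de_branges E \<Longrightarrow> de_branges_norm E (T F) \<le> C * de_branges_norm E F"
    using T unfolding bounded_operator_def by blast
  show thesis
  proof (rule that)
    fix F c z0
    assume F: "F \<in> de_branges E" and nz: "F z0 \<noteq> 0" and TF: "T F = (\<lambda>z. c * F z)"
    have "cmod c * de_branges_norm E F \<le> C * de_branges_norm E F"
      using C[OF F] unfolding TF de_branges_norm_mult .
    then show "cmod c \<le> C"
      using de_branges_norm_pos[OF E F nz] by simp
  qed
qed

lemma hausdorff_op_monomial:
  "hausdorff_op \<Phi> \<mu> (\<lambda>z. z ^ n) = (\<lambda>z. hausdorff_moment \<Phi> \<mu> n * z ^ n)"
proof
  fix z
  have "(\<lambda>u. \<Phi> u * (z / complex_of_real u) ^ n) = (\<lambda>u. \<Phi> u / complex_of_real u ^ n * z ^ n)"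
    by (simp add: power_divide)
  then show "hausdorff_op \<Phi> \<mu> (\<lambda>z. z ^ n) z = hausdorff_moment \<Phi> \<mu> n * z ^ n"
    unfolding hausdorff_op_def hausdorff_moment_def
    by (simp only: integral_mult_left_zero)
qed

section \<open>Negative moments of a nonnegative density\<close>

text \<open>This is Markov's inequality for the weight \<open>1 / u ^ n\<close>, which is at least \<open>1 / b ^ n\<close> on
  \<open>(0, b]\<close>. Both parts of (ii) rest on it.\<close>

lemma mass_le_negative_moment:
  fixes M :: "real measure" and g :: "real \<Rightarrow> real"
  assumes id: "(\<lambda>u. u) \<in> borel_measurable M"
    and pos: "\<And>u. u \<in> space M \<Longrightarrow> 0 < u" and nonneg: "\<And>u. u \<in> space M \<Longrightarrow> 0 \<le> g u"
    and int: "\<And>n::nat. integrable M (\<lambda>u. g u / u ^ n)"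
  shows "integrable M (\<lambda>u. indicator {..b} u * g u)"
    and "b > 0 \<Longrightarrow> (LINT u|M. indicator {..b} u * g u) \<le> b ^ n * (LINT u|M. g u / u ^ n)"
proof -
  note [measurable] = id
  have g: "integrable M g" using int[of 0] by simp
  have [measurable]: "(\<lambda>u. indicator {..b} u :: real) \<in> borel_measurable M"
    by measurable
  have [measurable]: "g \<in> borel_measurable M" using g by simp
  show i: "integrable M (\<lambda>u. indicator {..b} u * g u)"
    by (rule Bochner_Integration.integrable_bound[OF g]) (auto simp: indicator_def)
  show "(LINT u|M. indicator {..b} u * g u) \<le> b ^ n * (LINT u|M. g u / u ^ n)" if "b > 0"
  proof -
    have "(LINT u|M. indicator {..b} u * g u) \<le> (LINT u|M. b ^ n * (g u / u ^ n))"
    proof (rule integral_mono[OF i])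
      show "integrable M (\<lambda>u. b ^ n * (g u / u ^ n))"
        by (rule integrable_mult_right) (rule int)
      fix u assume u: "u \<in> space M"
      have "g u * u ^ n \<le> g u * b ^ n" if "u \<le> b"
        using that pos[OF u] nonneg[OF u] by (intro mult_left_mono power_mono) auto
      then show "indicator {..b} u * g u \<le> b ^ n * (g u / u ^ n)"
        using pos[OF u] nonneg[OF u] \<open>b > 0\<close> by (auto simp: indicator_def field_simps)
    qed
    also have "\<dots> = b ^ n * (LINT u|M. g u / u ^ n)"
      by (rule integral_mult_right_zero)
    finally show ?thesis .
  qed
qed

text \<open>Some initial interval \<open>(0, b]\<close> carries positive mass \<open>c\<close>, and then the \<open>n\<close>-th root of the
  moment is at least the \<open>n\<close>-th root of \<open>c\<close> divided by \<open>b\<close>.\<close>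

lemma liminf_root_negative_moments_pos:
  fixes M :: "real measure" and g :: "real \<Rightarrow> real"
  assumes id: "(\<lambda>u. u) \<in> borel_measurable M"
    and pos: "\<And>u. u \<in> space M \<Longrightarrow> 0 < u" and nonneg: "\<And>u. u \<in> space M \<Longrightarrow> 0 \<le> g u"
    and int: "\<And>n::nat. integrable M (\<lambda>u. g u / u ^ n)"
    and nz: "\<not> (AE u in M. g u = 0)"
  shows "liminf (\<lambda>n. ereal (root n (LINT u|M. g u / u ^ n))) > 0"
proof -
  let ?c = "\<lambda>b. LINT u|M. indicator {..b} u * g u"
  have mass_int: "integrable M (\<lambda>u. indicator {..b} u * g u)" for b
    by (intro mass_le_negative_moment id pos nonneg int)
  have mass_le: "?c b \<le> b ^ n * (LINT u|M. g u / u ^ n)" if "b > 0" for b n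
    by (intro mass_le_negative_moment id pos nonneg int that)
  have mass_nonneg: "?c b \<ge> 0" for b
    by (intro integral_nonneg_AE AE_I2) (simp add: nonneg)
  \<comment> \<open>Otherwise \<open>g\<close> would vanish almost everywhere on each of countably many intervals that
    exhaust the half-line. Taking \<open>Suc k\<close> as the endpoint keeps it positive.\<close>
  have "\<exists>k::nat. ?c (real (Suc k)) \<noteq> 0"
  proof (rule ccontr)
    assume "\<not> ?thesis"
    then have "AE u in M. indicator {..real (Suc k)} u * g u = 0" for k
      using integral_nonneg_eq_0_iff_AE[OF mass_int[of "real (Suc k)"]] nonneg by simp
    then have "AE u in M. \<forall>k. indicator {..real (Suc k)} u * g u = 0"
      by (simp only: AE_all_countable) simp
    then have "AE u in M. g u = 0"
    proof eventually_elim
      case (elim u)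
      obtain k where "u \<le> real k" using real_arch_simple by blast
      then have "u \<le> real (Suc k)" by simp
      with elim[rule_format, of k] show ?case by (simp add: indicator_def)
    qed
    with nz show False by simp
  qed
  then obtain b where b: "b > 0" and c: "?c b > 0"
    using mass_nonneg by (metis less_eq_real_def of_nat_0_less_iff zero_less_Suc)
  have "(\<lambda>n. root n (?c b) / b) \<longlonglongrightarrow> 1 / b"
    using LIMSEQ_root_const[OF c] b by (intro tendsto_intros) auto
  then have lim: "liminf (\<lambda>n. ereal (root n (?c b) / b)) = ereal (1 / b)"
    by (intro lim_imp_Liminf) auto
  have "root n (?c b) / b \<le> root n (LINT u|M. g u / u ^ n)" if "n > 0" for n
  proof -
    have "root n (?c b) \<le> root n (b ^ n * (LINT u|M. g u / u ^ n))"
      using that mass_le[OF b] by simp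
    also have "\<dots> = b * root n (LINT u|M. g u / u ^ n)"
      using that b by (simp add: real_root_mult real_root_power_cancel)
    finally show ?thesis using b by (simp add: field_simps)
  qed
  then have "liminf (\<lambda>n. ereal (root n (?c b) / b))
      \<le> liminf (\<lambda>n. ereal (root n (LINT u|M. g u / u ^ n)))"
    by (intro Liminf_mono eventually_mono[OF eventually_gt_at_top[of 0]]) simp
  moreover have "ereal (1 / b) > 0" using b by simp
  ultimately show ?thesis using lim by (metis order_less_le_trans)
qed

text \<open>For \<open>b < 1 / a\<close> the mass of \<open>(0, b]\<close> is at most \<open>(b * a) ^ n\<close> for every \<open>n \<ge> 1\<close>,
  hence zero.\<close>

lemma ae_zero_of_negative_moments_le_power:
  fixes M :: "real measure" and g :: "real \<Rightarrow> real"
  assumes id: "(\<lambda>u. u) \<in> borel_measurable M"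
    and pos: "\<And>u. u \<in> space M \<Longrightarrow> 0 < u" and nonneg: "\<And>u. u \<in> space M \<Longrightarrow> 0 \<le> g u"
    and int: "\<And>n::nat. integrable M (\<lambda>u. g u / u ^ n)"
    and a: "a > 0" and le: "\<And>n. n \<ge> 1 \<Longrightarrow> (LINT u|M. g u / u ^ n) \<le> a ^ n"
  shows "AE u in M. u < 1 / a \<longrightarrow> g u = 0"
proof -
  let ?c = "\<lambda>b. LINT u|M. indicator {..b} u * g u"
  have mass_int: "integrable M (\<lambda>u. indicator {..b} u * g u)" for b
    by (intro mass_le_negative_moment id pos nonneg int)
  have mass_le: "?c b \<le> b ^ n * (LINT u|M. g u / u ^ n)" if "b > 0" for b n
    by (intro mass_le_negative_moment id pos nonneg int that)
  have zero: "AE u in M. indicator {..b} u * g u = 0" if b: "b > 0" "b < 1 / a" for b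
  proof -
    have "?c b \<le> (b * a) ^ n" if "n \<ge> 1" for n
      using mass_le[OF b(1), of n]
        mult_left_mono[OF le[OF that] zero_le_power[OF less_imp_le[OF b(1)], of n]]
      unfolding power_mult_distrib by linarith
    moreover have "(\<lambda>n. (b * a) ^ n) \<longlonglongrightarrow> 0"
      using a b by (intro LIMSEQ_realpow_zero) (auto simp: field_simps)
    ultimately have "?c b \<le> 0"
      by (intro LIMSEQ_le_const[of _ 0]) auto
    moreover have "?c b \<ge> 0"
      by (intro integral_nonneg_AE AE_I2) (simp add: nonneg)
    ultimately show ?thesis
      using integral_nonneg_eq_0_iff_AE[OF mass_int[of b]] nonneg by simp
  qed
  \<comment> \<open>\<open>zero\<close> covers only \<open>b < 1 / a\<close>, so exhaust \<open>(0, 1 / a)\<close> by countably many intervals; the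
    shift by \<open>2\<close> keeps every \<open>b k\<close> positive.\<close>
  define b where "b k = (1 - 1 / real (k + 2)) / a" for k
  have "b k > 0" "b k < 1 / a" for k
    unfolding b_def using a by (auto intro!: divide_pos_pos divide_strict_right_mono)
  then have "AE u in M. \<forall>k. indicator {..b k} u * g u = 0"
    using zero by (simp only: AE_all_countable) simp
  then show ?thesis
  proof eventually_elim
    case (elim u)
    have "b \<longlonglongrightarrow> (1 - 0) / a"
      unfolding b_def using a
      by (intro tendsto_intros LIMSEQ_ignore_initial_segment[OF lim_1_over_n]) simp
    then have "u < 1 / a \<Longrightarrow> \<exists>k. u < b k"
      using order_tendstoD(1)[of b "1 / a" sequentially u] eventually_happens by force
    moreover have "g u = 0" if "u < b k" for k
      using elim[rule_format, of k] that by (simp add: indicator_def)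
    ultimately show ?case by blast
  qed
qed

section \<open>Moments of a bounded Hausdorff operator\<close>

theorem theorem3:
  fixes E :: "complex \<Rightarrow> complex" and \<Phi> :: "real \<Rightarrow> complex" and \<mu> :: "real measure"
  assumes "regular_borel_measure \<mu>"
    and "\<Phi> \<in> borel_measurable (completion \<mu>)"
    and "\<And>n::nat. integrable (completion \<mu>) (\<lambda>u. \<Phi> u / complex_of_real u ^ n)"
    and "hermite_biehler E"
    and "\<And>p :: complex poly. poly p \<in> de_branges E"
    and "hausdorff_bounded E \<Phi> \<mu>"
  shows "(SUP n. ereal (cmod (hausdorff_moment \<Phi> \<mu> n)))
           \<le> op_spectral_radius E (hausdorff_op \<Phi> \<mu>) \<and>
         ((\<forall>u>0. \<Phi> u \<in> \<real>\<^sub>\<ge>\<^sub>0) \<and> (\<exists>F\<in>de_branges E. hausdorff_op \<Phi> \<mu> F \<noteq> (\<lambda>z. 0)) \<longrightarrow>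
           liminf (\<lambda>n. ereal (root n (Re (hausdorff_moment \<Phi> \<mu> n)))) > 0 \<and>
           (let A = (SUP n\<in>{1..}. ereal (root n (Re (hausdorff_moment \<Phi> \<mu> n)))) in
              A < \<infinity> \<and> (AE u in \<mu>. ereal u < 1 / A \<longrightarrow> \<Phi> u = 0)))"
proof (intro conjI impI)
  let ?T = "hausdorff_op \<Phi> \<mu>" and ?m = "hausdorff_moment \<Phi> \<mu>"
  have monom: "(\<lambda>z. z ^ n) \<in> de_branges E" for n
    using assms(5)[of "monom 1 n"] by (simp add: poly_monom[abs_def])
  have nz: "(1::complex) ^ n \<noteq> 0" for n :: nat by simp
  have "?m n \<in> op_spectrum E ?T" for n
    using eigenvalue_in_op_spectrum[where F = "\<lambda>z. z ^ n" and ?z0.0 = 1]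
      monom nz hausdorff_op_monomial by blast
  then show "(SUP n. ereal (cmod (?m n))) \<le> op_spectral_radius E ?T"
    unfolding op_spectral_radius_def by (intro SUP_least SUP_upper)

  assume asm: "(\<forall>u>0. \<Phi> u \<in> \<real>\<^sub>\<ge>\<^sub>0) \<and> (\<exists>F\<in>de_branges E. ?T F \<noteq> (\<lambda>z. 0))"
  let ?M = "completion \<mu>"
  have sets: "sets \<mu> = sets (restrict_space borel {0<..})"
    using assms(1) by (simp add: regular_borel_measure_def)
  then have space [simp]: "space \<mu> = {0<..}"
    using sets_eq_imp_space_eq[OF sets] by (simp add: space_restrict_space)
  have "(\<lambda>u. u) \<in> borel_measurable \<mu>"
    unfolding measurable_cong_sets[OF sets refl] by (intro measurable_restrict_space1) simp
  then have id: "(\<lambda>u. u) \<in> borel_measurable ?M"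
    by (rule measurable_completion)
  define g where "g u = Re (\<Phi> u)" for u
  have \<Phi>: "\<Phi> u = complex_of_real (g u)" and nonneg: "0 \<le> g u" if "u \<in> space ?M" for u
    using asm that by (auto simp: g_def complex_nonneg_Reals_iff complex_eq_iff)
  have pos: "0 < u" if "u \<in> space ?M" for u using that by simp
  have Re: "Re (\<Phi> u / complex_of_real u ^ n) = g u / u ^ n" for u n
    unfolding g_def of_real_power[symmetric] by (rule Re_divide_of_real)
  have int: "integrable ?M (\<lambda>u. g u / u ^ n)" for n :: nat
    using integrable_Re[OF assms(3)[of n]] by (simp only: Re)
  have m: "Re (?m n) = (LINT u|?M. g u / u ^ n)" for n
    using integral_Re[OF assms(3)[of n]] by (simp only: Re hausdorff_moment_def)
  have m_nonneg: "Re (?m n) \<ge> 0" for n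
    unfolding m using pos nonneg by (intro integral_nonneg_AE AE_I2) (simp add: less_imp_le)

  have "\<not> (AE u in ?M. g u = 0)"
  proof
    assume "AE u in ?M. g u = 0"
    then have \<Phi>0: "AE u in ?M. \<Phi> u = 0"
      by (rule AE_mp) (intro AE_I2 impI, simp add: \<Phi>)
    have "?T F z = 0" for F z
      unfolding hausdorff_op_def
      by (rule integral_eq_zero_AE) (use \<Phi>0 in eventually_elim, simp)
    with asm show False by auto
  qed
  then show liminf_pos: "liminf (\<lambda>n. ereal (root n (Re (?m n)))) > 0"
    unfolding m by (intro liminf_root_negative_moments_pos id pos nonneg int)

  have "bounded_operator E ?T"
    using assms(6) by (simp add: hausdorff_bounded_def)
  then obtain C where
    "\<And>F c z0. F \<in> de_branges E \<Longrightarrow> F z0 \<noteq> 0 \<Longrightarrow> ?T F = (\<lambda>z. c * F z) \<Longrightarrow> cmod c \<le> C"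
    using eigenvalues_bounded[OF assms(4)] by blast
  then have C: "cmod (?m n) \<le> C" for n
    using monom nz hausdorff_op_monomial by blast
  define A where "A = (SUP n\<in>{1..}. ereal (root n (Re (?m n))))"
  \<comment> \<open>The \<open>n\<close>-th root of a number in \<open>(0, 1)\<close> is at least that number, so \<open>C\<close> alone need not be a
    bound.\<close>
  have "A \<le> ereal (max 1 C)"
    unfolding A_def
  proof (intro SUP_least)
    fix n :: nat assume n: "n \<in> {1..}"
    have "Re (?m n) \<le> max 1 C"
      using C[of n] complex_Re_le_cmod[of "?m n"] by linarith
    also have "\<dots> \<le> max 1 C ^ n"
      using n by (intro self_le_power) auto
    finally have "root n (Re (?m n)) \<le> root n (max 1 C ^ n)"
      using n by simp
    also have "\<dots> = max 1 C"
      using n by (intro real_root_power_cancel) auto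
    finally show "ereal (root n (Re (?m n))) \<le> ereal (max 1 C)"
      by (simp only: ereal_less_eq)
  qed
  then have "A < \<infinity>" by (rule order_le_less_trans) (simp only: less_ereal.simps)
  \<comment> \<open>\<open>A = 0\<close> has to be excluded to read \<open>1 / A\<close> as a real number.\<close>
  moreover have "A > 0"
  proof -
    have "liminf (\<lambda>n. ereal (root n (Re (?m n)))) \<le> limsup (\<lambda>n. ereal (root n (Re (?m n))))"
      by (intro Liminf_le_Limsup) simp
    also have "\<dots> \<le> A"
      unfolding A_def
      by (intro Limsup_bounded eventually_mono[OF eventually_ge_at_top[of 1]] SUP_upper) simp
    finally show ?thesis using liminf_pos by (rule order_less_le_trans[rotated])
  qed
  ultimately obtain a where a: "A = ereal a" "a > 0"
    by (cases A) auto
  have "(LINT u|?M. g u / u ^ n) \<le> a ^ n" if n: "n \<ge> 1" for n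
  proof -
    have "ereal (root n (Re (?m n))) \<le> A"
      unfolding A_def using n by (intro SUP_upper) simp
    then have "root n (Re (?m n)) ^ n \<le> a ^ n"
      using a n m_nonneg by (intro power_mono) auto
    then show ?thesis using n m_nonneg by (simp add: m[symmetric])
  qed
  then have "AE u in ?M. u < 1 / a \<longrightarrow> g u = 0"
    by (intro ae_zero_of_negative_moments_le_power id pos nonneg int a)
  then have "AE u in ?M. u < 1 / a \<longrightarrow> \<Phi> u = 0"
    by (rule AE_mp) (intro AE_I2 impI, simp add: \<Phi>)
  then have "AE u in \<mu>. ereal u < 1 / A \<longrightarrow> \<Phi> u = 0"
    unfolding AE_completion_iff using a by (simp add: one_ereal_def)
  with \<open>A < \<infinity>\<close> show "let A = (SUP n\<in>{1..}. ereal (root n (Re (?m n)))) in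
      A < \<infinity> \<and> (AE u in \<mu>. ereal u < 1 / A \<longrightarrow> \<Phi> u = 0)"
    by (simp add: A_def)
qed

end
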